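(* For every $s\in\mathbb{C}\cup\{\infty\}$ the family of Lie algebras $\mathcal{W}^{(s)}_t$ with basis $\{V_n\mid n\in\mathbb{Z}\}$ defined, for $s\neq\infty$, by $$[V_n,V_m]=\begin{cases}(m-n)V_{n+m},& n,m\ \text{odd},\\ (m-n)\big(V_{n+m}+3t\,V_{n+m-2}+t^2(1-s)(2+s)V_{n+m-4}\big),& n,m\ \text{even},\\ (m-n)V_{n+m}+(m-n-1)\,3t\,V_{n+m-2}+(m-n-2)\,t^2(1-s)(2+s)V_{n+m-4},& n\ \text{odd},\ m\ \text{even},\end{cases}$$ and, for $s=\infty$, by $$[V_n,V_m]=\begin{cases}(m-n)V_{n+m},& n,m\ \text{odd},\\ (m-n)\big(V_{n+m}-t^2V_{n+m-4}\big),& n,m\ \text{even},\\ (m-n)V_{n+m}-(m-n-2)\,t^2V_{n+m-4},& n\ \text{odd},\ m\ \text{even},\end{cases}$$ is a global deformation of the Witt algebra $\mathcal{W}$ over the affine line, i.e. with base $\mathbb{C}[t]$. For every $s$ the Lie algebra over $t=0$ is the Witt algebra $\mathcal{W}$; for fixed $s$ the Lie algebras $\mathcal{W}^{(s)}_t$ over the points $t\neq 0$ are all mutually isomorphic, but they are not isomorphic to the Witt algebra.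
   Context: The Witt algebra $\mathcal{W}$ is the complex Lie algebra with basis $\{l_n\mid n\in\mathbb{Z}\}$ and bracket $[l_n,l_m]=(m-n)l_{n+m}$. Elements of all algebras considered are finite linear combinations of basis elements; the bracket for $n$ even, $m$ odd is determined by antisymmetry. Let $A$ be a commutative $\mathbb{K}$-algebra with unit and an augmentation $\epsilon:A\to\mathbb{K}$ (a $\mathbb{K}$-algebra homomorphism), $m=\mathrm{Ker}\,\epsilon$. A global deformation of a Lie algebra $\mathcal{L}$ over $\mathbb{K}$ with base $(A,m)$ is a Lie $A$-algebra structure on $A\otimes_{\mathbb{K}}\mathcal{L}$ such that $\epsilon\otimes\mathrm{id}:A\otimes\mathcal{L}\to\mathbb{K}\otimes\mathcal{L}=\mathcal{L}$ is a Lie algebra homomorphism. A deformation over the affine line is one with $A=\mathbb{C}[t]$ and (as base point) the augmentation $t\mapsto 0$; the Lie algebra over (or "above") the point $t=\alpha\in\mathbb{C}$ is the complex Lie algebra obtained by reducing the structure constants modulo $(t-\alpha)$. Here the basis element $V_n$ is identified with $1\otimes l_n\in\mathbb{C}[t]\otimes\mathcal{W}$. *)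

theory Defs
  imports
    "HOL-Library.Poly_Mapping"
    "HOL-Computational_Algebra.Polynomial"
    Complex_Main
begin

section \<open>Lie algebras over commutative rings\<close>

locale lie_algebra = module scale
  for scale :: "'a::comm_ring_1 \<Rightarrow> 'v::ab_group_add \<Rightarrow> 'v" +
  fixes bracket :: "'v \<Rightarrow> 'v \<Rightarrow> 'v"
  assumes bracket_add_left: "bracket (x + y) z = bracket x z + bracket y z"
    and bracket_add_right: "bracket x (y + z) = bracket x y + bracket x z"
    and bracket_scale_left: "bracket (scale a x) y = scale a (bracket x y)"
    and bracket_scale_right: "bracket x (scale a y) = scale a (bracket x y)"
    and bracket_self: "bracket x x = 0"
    and jacobi: "bracket x (bracket y z) + bracket y (bracket z x) + bracket z (bracket x y) = 0"

definition lie_algebra_hom ::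
  "('a::comm_ring_1 \<Rightarrow> 'v::ab_group_add \<Rightarrow> 'v) \<Rightarrow> ('v \<Rightarrow> 'v \<Rightarrow> 'v) \<Rightarrow>
   ('a \<Rightarrow> 'w::ab_group_add \<Rightarrow> 'w) \<Rightarrow> ('w \<Rightarrow> 'w \<Rightarrow> 'w) \<Rightarrow> ('v \<Rightarrow> 'w) \<Rightarrow> bool"
  where "lie_algebra_hom s1 br1 s2 br2 f \<longleftrightarrow>
    module_hom s1 s2 f \<and> (\<forall>x y. f (br1 x y) = br2 (f x) (f y))"

definition lie_isomorphic ::
  "('a::comm_ring_1 \<Rightarrow> 'v::ab_group_add \<Rightarrow> 'v) \<Rightarrow> ('v \<Rightarrow> 'v \<Rightarrow> 'v) \<Rightarrow>
   ('a \<Rightarrow> 'w::ab_group_add \<Rightarrow> 'w) \<Rightarrow> ('w \<Rightarrow> 'w \<Rightarrow> 'w) \<Rightarrow> bool"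
  where "lie_isomorphic s1 br1 s2 br2 \<longleftrightarrow> (\<exists>f. lie_algebra_hom s1 br1 s2 br2 f \<and> bij f)"

section \<open>Free modules and extension of scalars\<close>

text \<open>
  A vector space with basis indexed by \<open>'i\<close> is rendered as the type of finitely supported
  functions \<open>'i \<Rightarrow>\<^sub>0 'k\<close>.  For a commutative algebra \<open>A\<close> with structure map \<open>\<iota> : K \<rightarrow> A\<close>, the
  tensor product of \<open>A\<close> with this space over \<open>K\<close> is then \<open>'i \<Rightarrow>\<^sub>0 'a\<close>, the pure tensors being
  given by \<open>tensor \<iota>\<close>; \<open>tensor_universal\<close> is its universal property, and
  \<open>map_coeffs_tensor\<close> identifies \<open>\<epsilon> \<otimes> id\<close> with \<open>map_coeffs \<epsilon>\<close>.
\<close>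

definition fscale :: "'a::comm_ring_1 \<Rightarrow> ('i \<Rightarrow>\<^sub>0 'a) \<Rightarrow> ('i \<Rightarrow>\<^sub>0 'a)"
  where "fscale a u = Poly_Mapping.map ((*) a) u"

text \<open>Only meaningful for maps \<open>h\<close> with \<open>h 0 = 0\<close>.\<close>

definition map_coeffs :: "('a::zero \<Rightarrow> 'b::zero) \<Rightarrow> ('i \<Rightarrow>\<^sub>0 'a) \<Rightarrow> ('i \<Rightarrow>\<^sub>0 'b)"
  where "map_coeffs h u = Poly_Mapping.map h u"

definition tensor ::
  "('k::comm_ring_1 \<Rightarrow> 'a::comm_ring_1) \<Rightarrow> 'a \<Rightarrow> ('i \<Rightarrow>\<^sub>0 'k) \<Rightarrow> ('i \<Rightarrow>\<^sub>0 'a)"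
  where "tensor \<iota> a x = fscale a (map_coeffs \<iota> x)"

abbreviation V :: "'i \<Rightarrow> ('i \<Rightarrow>\<^sub>0 'a::comm_ring_1)"
  where "V i \<equiv> Poly_Mapping.single i 1"

definition unital_ring_hom :: "('a::comm_ring_1 \<Rightarrow> 'b::comm_ring_1) \<Rightarrow> bool"
  where "unital_ring_hom h \<longleftrightarrow>
    (\<forall>x y. h (x + y) = h x + h y) \<and> (\<forall>x y. h (x * y) = h x * h y) \<and> h 1 = 1"

lemma unital_ring_hom_0: "unital_ring_hom h \<Longrightarrow> h 0 = 0"
  unfolding unital_ring_hom_def by (metis add_cancel_right_right)

lemma lookup_fscale [simp]: "Poly_Mapping.lookup (fscale a u) i = a * Poly_Mapping.lookup u i"
  by (simp add: fscale_def Poly_Mapping.map.rep_eq when_def)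

lemma lookup_map_coeffs:
  "h 0 = 0 \<Longrightarrow> Poly_Mapping.lookup (map_coeffs h u) i = h (Poly_Mapping.lookup u i)"
  by (simp add: map_coeffs_def Poly_Mapping.map.rep_eq when_def)

lemma module_fscale: "module (fscale :: 'a::comm_ring_1 \<Rightarrow> ('i \<Rightarrow>\<^sub>0 'a) \<Rightarrow> _)"
  by unfold_locales (auto intro!: poly_mapping_eqI simp: lookup_add algebra_simps)

lemma fscale_expansion:
  "u = (\<Sum>i\<in>Poly_Mapping.keys u. fscale (Poly_Mapping.lookup u i) (V i))"
proof (rule poly_mapping_eqI)
  fix j
  have "Poly_Mapping.lookup (fscale (Poly_Mapping.lookup u i) (V i)) j
      = (if i = j then Poly_Mapping.lookup u j else 0)" for i
    by (simp add: lookup_single when_def)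
  then show "Poly_Mapping.lookup u j =
      Poly_Mapping.lookup (\<Sum>i\<in>Poly_Mapping.keys u. fscale (Poly_Mapping.lookup u i) (V i)) j"
    by (simp add: lookup_sum in_keys_iff)
qed

lemma lookup_tensor:
  assumes "unital_ring_hom \<iota>"
  shows "Poly_Mapping.lookup (tensor \<iota> a x) i = a * \<iota> (Poly_Mapping.lookup x i)"
  by (simp add: tensor_def lookup_map_coeffs[of \<iota>, OF unital_ring_hom_0[OF assms]])

lemma tensor_V:
  assumes "unital_ring_hom \<iota>"
  shows "tensor \<iota> a (V i) = fscale a (V i)"
proof -
  have "\<iota> 0 = 0" "\<iota> 1 = 1"
    using unital_ring_hom_0[OF assms] assms by (auto simp: unital_ring_hom_def)
  then show ?thesis
    by (intro poly_mapping_eqI) (simp add: lookup_tensor[OF assms] lookup_single when_def)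
qed

lemma tensor_one_V: "unital_ring_hom \<iota> \<Longrightarrow> tensor \<iota> 1 (V i) = V i"
  by (simp add: tensor_V module.scale_one[OF module_fscale])

lemma tensor_balanced:
  assumes "unital_ring_hom \<iota>"
  shows "tensor \<iota> (a + b) x = tensor \<iota> a x + tensor \<iota> b x"
    and "tensor \<iota> a (x + y) = tensor \<iota> a x + tensor \<iota> a y"
    and "tensor \<iota> (a * \<iota> c) x = tensor \<iota> a (fscale c x)"
proof -
  have "\<iota> (u + v) = \<iota> u + \<iota> v" "\<iota> (u * v) = \<iota> u * \<iota> v" for u v
    using assms by (auto simp: unital_ring_hom_def)
  then show "tensor \<iota> (a + b) x = tensor \<iota> a x + tensor \<iota> b x"
    "tensor \<iota> a (x + y) = tensor \<iota> a x + tensor \<iota> a y"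
    "tensor \<iota> (a * \<iota> c) x = tensor \<iota> a (fscale c x)"
    by (auto intro!: poly_mapping_eqI simp: lookup_tensor[OF assms] lookup_add algebra_simps)
qed

lemma map_coeffs_tensor:
  assumes \<iota>: "unital_ring_hom \<iota>" and \<epsilon>: "unital_ring_hom \<epsilon>" and id: "\<And>c. \<epsilon> (\<iota> c) = c"
  shows "map_coeffs \<epsilon> (tensor \<iota> a x) = fscale (\<epsilon> a) x"
proof -
  have "\<epsilon> (u * v) = \<epsilon> u * \<epsilon> v" for u v
    using \<epsilon> by (auto simp: unital_ring_hom_def)
  then show ?thesis
    by (intro poly_mapping_eqI)
      (simp add: lookup_map_coeffs[of \<epsilon>, OF unital_ring_hom_0[OF \<epsilon>]] lookup_tensor[OF \<iota>] id)
qed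

lemma tensor_universal:
  fixes \<iota> :: "'k::comm_ring_1 \<Rightarrow> 'a::comm_ring_1"
    and \<beta> :: "'a \<Rightarrow> ('i \<Rightarrow>\<^sub>0 'k) \<Rightarrow> 'n::ab_group_add"
  assumes \<iota>: "unital_ring_hom \<iota>"
    and add1: "\<And>a b x. \<beta> (a + b) x = \<beta> a x + \<beta> b x"
    and add2: "\<And>a x y. \<beta> a (x + y) = \<beta> a x + \<beta> a y"
    and bal: "\<And>a c x. \<beta> (a * \<iota> c) x = \<beta> a (fscale c x)"
  shows "\<exists>!\<phi>. (\<forall>u v. \<phi> (u + v) = \<phi> u + \<phi> v) \<and> (\<forall>a x. \<phi> (tensor \<iota> a x) = \<beta> a x)"
proof -
  define \<phi> where "\<phi> u = (\<Sum>i\<in>Poly_Mapping.keys u. \<beta> (Poly_Mapping.lookup u i) (V i))" for u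
  have b0: "\<beta> 0 x = 0" for x using add1[of 0 0 x] by simp
  have b0': "\<beta> a 0 = 0" for a using add2[of a 0 0] by simp
  have ext: "\<phi> u = (\<Sum>i\<in>S. \<beta> (Poly_Mapping.lookup u i) (V i))" if "finite S" "Poly_Mapping.keys u \<subseteq> S" for u S
    unfolding \<phi>_def using that by (intro sum.mono_neutral_left) (auto simp: in_keys_iff b0)
  have add: "\<phi> (u + v) = \<phi> u + \<phi> v" for u v
    using Poly_Mapping.keys_add[of u v]
    by (simp add: ext[of "Poly_Mapping.keys u \<union> Poly_Mapping.keys v"] lookup_add add1 sum.distrib)
  have bsum: "\<beta> a (\<Sum>i\<in>S. f i) = (\<Sum>i\<in>S. \<beta> a (f i))" for a and f :: "'i \<Rightarrow> _" and S
    by (induction S rule: infinite_finite_induct) (auto simp: b0' add2)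
  have val: "\<phi> (tensor \<iota> a x) = \<beta> a x" for a x
  proof -
    note l = lookup_tensor[OF \<iota>, of a x]
    have "Poly_Mapping.keys (tensor \<iota> a x) \<subseteq> Poly_Mapping.keys x"
      using unital_ring_hom_0[OF \<iota>] by (auto simp: in_keys_iff l)
    then have "\<phi> (tensor \<iota> a x) = (\<Sum>i\<in>Poly_Mapping.keys x. \<beta> (a * \<iota> (Poly_Mapping.lookup x i)) (V i))"
      by (simp add: ext[of "Poly_Mapping.keys x"] l)
    also have "\<dots> = \<beta> a (\<Sum>i\<in>Poly_Mapping.keys x. fscale (Poly_Mapping.lookup x i) (V i))"
      by (simp add: bal bsum)
    finally show ?thesis by (simp flip: fscale_expansion)
  qed
  have uniq: "\<psi> = \<phi>"
    if \<psi>: "\<forall>u v. \<psi> (u + v) = \<psi> u + \<psi> v" "\<forall>a x. \<psi> (tensor \<iota> a x) = \<beta> a x" for \<psi>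
  proof
    fix u
    have "\<psi> 0 = 0" using \<psi>(1) by (metis add_cancel_right_right)
    then have psum: "\<psi> (\<Sum>i\<in>S. f i) = (\<Sum>i\<in>S. \<psi> (f i))" for f :: "'i \<Rightarrow> _" and S
      by (induction S rule: infinite_finite_induct) (auto simp: \<psi>(1))
    have "\<psi> u = \<psi> (\<Sum>i\<in>Poly_Mapping.keys u. fscale (Poly_Mapping.lookup u i) (V i))"
      by (simp flip: fscale_expansion)
    then show "\<psi> u = \<phi> u"
      by (simp add: psum \<psi>(2) \<phi>_def flip: tensor_V[OF \<iota>])
  qed
  show ?thesis
    using add val uniq by (intro ex1I[of _ \<phi>]) auto
qed

section \<open>Global deformations and their fibres\<close>

text \<open>
  The base is \<open>(A, Ker \<epsilon>)\<close>, where \<open>A\<close> is a \<open>K\<close>-algebra through \<open>\<iota>\<close>.  The homomorphism condition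
  on \<open>\<epsilon> \<otimes> id\<close> is one over \<open>K\<close>, with \<open>K\<close> acting on \<open>A \<otimes> L\<close> through \<open>\<iota>\<close>.
\<close>

definition global_deformation ::
  "('k::field \<Rightarrow> 'a::comm_ring_1) \<Rightarrow> ('a \<Rightarrow> 'k) \<Rightarrow>
   (('i \<Rightarrow>\<^sub>0 'k) \<Rightarrow> ('i \<Rightarrow>\<^sub>0 'k) \<Rightarrow> ('i \<Rightarrow>\<^sub>0 'k)) \<Rightarrow>
   (('i \<Rightarrow>\<^sub>0 'a) \<Rightarrow> ('i \<Rightarrow>\<^sub>0 'a) \<Rightarrow> ('i \<Rightarrow>\<^sub>0 'a)) \<Rightarrow> bool"
  where "global_deformation \<iota> \<epsilon> brL brA \<longleftrightarrow>
    unital_ring_hom \<iota> \<and> unital_ring_hom \<epsilon> \<and> (\<forall>c. \<epsilon> (\<iota> c) = c) \<and>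
    lie_algebra fscale brL \<and> lie_algebra fscale brA \<and>
    lie_algebra_hom (\<lambda>c. fscale (\<iota> c)) brA fscale brL (map_coeffs \<epsilon>)"

definition affine_line_deformation ::
  "(('i \<Rightarrow>\<^sub>0 complex) \<Rightarrow> ('i \<Rightarrow>\<^sub>0 complex) \<Rightarrow> ('i \<Rightarrow>\<^sub>0 complex)) \<Rightarrow>
   (('i \<Rightarrow>\<^sub>0 complex poly) \<Rightarrow> ('i \<Rightarrow>\<^sub>0 complex poly) \<Rightarrow> ('i \<Rightarrow>\<^sub>0 complex poly)) \<Rightarrow> bool"
  where "affine_line_deformation brL brA \<longleftrightarrow>
    global_deformation (\<lambda>c. [:c:]) (\<lambda>p. poly p 0) brL brA"

definition bilinear_extension ::
  "('i \<Rightarrow> 'i \<Rightarrow> ('i \<Rightarrow>\<^sub>0 'a)) \<Rightarrow> ('i \<Rightarrow>\<^sub>0 'a) \<Rightarrow> ('i \<Rightarrow>\<^sub>0 'a) \<Rightarrow> ('i \<Rightarrow>\<^sub>0 'a::comm_ring_1)"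
  where "bilinear_extension C x y =
    (\<Sum>i\<in>Poly_Mapping.keys x. \<Sum>j\<in>Poly_Mapping.keys y.
      fscale (Poly_Mapping.lookup x i * Poly_Mapping.lookup y j) (C i j))"

lemma bilinear_extension_V: "bilinear_extension C (V i) (V j) = C i j"
  using module.scale_one[OF module_fscale] by (simp add: bilinear_extension_def)

text \<open>
  Structure constants are reduced modulo \<open>t - \<alpha>\<close> in \<open>fibre\<close> by evaluating them at \<open>\<alpha>\<close>.
\<close>

lemma reduce_mod: "p mod [:- \<alpha>, 1:] = [:poly p (\<alpha> :: 'a :: field):]"
proof -
  have "[:- \<alpha>, 1:] dvd p - [:poly p \<alpha>:]"
    by (simp flip: poly_eq_0_iff_dvd)
  then have "p mod [:- \<alpha>, 1:] = [:poly p \<alpha>:] mod [:- \<alpha>, 1:]"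
    by (simp add: mod_eq_dvd_iff)
  then show ?thesis
    by (simp add: mod_poly_less)
qed

definition fibre ::
  "(('i \<Rightarrow>\<^sub>0 complex poly) \<Rightarrow> ('i \<Rightarrow>\<^sub>0 complex poly) \<Rightarrow> ('i \<Rightarrow>\<^sub>0 complex poly)) \<Rightarrow> complex \<Rightarrow>
   ('i \<Rightarrow>\<^sub>0 complex) \<Rightarrow> ('i \<Rightarrow>\<^sub>0 complex) \<Rightarrow> ('i \<Rightarrow>\<^sub>0 complex)"
  where "fibre br \<alpha> =
    bilinear_extension (\<lambda>i j. map_coeffs (\<lambda>p. poly p \<alpha>) (br (V i) (V j)))"

section \<open>The Witt algebra and the families\<close>

definition witt_bracket :: "(int \<Rightarrow>\<^sub>0 complex) \<Rightarrow> (int \<Rightarrow>\<^sub>0 complex) \<Rightarrow> (int \<Rightarrow>\<^sub>0 complex)"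
  where "witt_bracket = bilinear_extension (\<lambda>n m. fscale (of_int (m - n)) (V (n + m)))"

datatype ext_complex = Fin complex | Infinity

definition T :: "complex poly"
  where "T = [:0, 1:]"

fun even_even :: "ext_complex \<Rightarrow> int \<Rightarrow> int \<Rightarrow> (int \<Rightarrow>\<^sub>0 complex poly)" where
  "even_even (Fin s) n m =
     fscale (of_int (m - n))
       (V (n + m) + fscale (3 * T) (V (n + m - 2))
         + fscale (T\<^sup>2 * [:(1 - s) * (2 + s):]) (V (n + m - 4)))"
| "even_even Infinity n m =
     fscale (of_int (m - n)) (V (n + m) - fscale (T\<^sup>2) (V (n + m - 4)))"

fun odd_even :: "ext_complex \<Rightarrow> int \<Rightarrow> int \<Rightarrow> (int \<Rightarrow>\<^sub>0 complex poly)" where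
  "odd_even (Fin s) n m =
     fscale (of_int (m - n)) (V (n + m))
     + fscale (of_int (m - n - 1) * (3 * T)) (V (n + m - 2))
     + fscale (of_int (m - n - 2) * (T\<^sup>2 * [:(1 - s) * (2 + s):])) (V (n + m - 4))"
| "odd_even Infinity n m =
     fscale (of_int (m - n)) (V (n + m))
     - fscale (of_int (m - n - 2) * T\<^sup>2) (V (n + m - 4))"

definition family_basis_bracket :: "ext_complex \<Rightarrow> int \<Rightarrow> int \<Rightarrow> (int \<Rightarrow>\<^sub>0 complex poly)"
  where "family_basis_bracket s n m =
    (if odd n \<and> odd m then fscale (of_int (m - n)) (V (n + m))
     else if even n \<and> even m then even_even s n m
     else if odd n then odd_even s n m
     else - odd_even s m n)"

definition family_bracket ::
  "ext_complex \<Rightarrow> (int \<Rightarrow>\<^sub>0 complex poly) \<Rightarrow> (int \<Rightarrow>\<^sub>0 complex poly) \<Rightarrow> (int \<Rightarrow>\<^sub>0 complex poly)"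
  where "family_bracket s = bilinear_extension (family_basis_bracket s)"

end

theory Submission
  imports Defs
begin

text \<open>
  All members of the family are specialisations of one Lie algebra \<open>kn_bracket a c\<close>, defined over
  any commutative ring containing \<open>a\<close> and \<open>c\<close>: the family is the case \<open>a = 3t\<close>,
  \<open>c = t\<^sup>2(1 - s)(2 + s)\<close> (respectively \<open>a = 0\<close>, \<open>c = -t\<^sup>2\<close>) over the polynomial ring, its
  fibres are obtained by substituting a number for \<open>t\<close>, and the Witt algebra is the case
  \<open>a = c = 0\<close>.  The Jacobi identity is verified once, on basis vectors, according to the parities
  of the three indices (\<open>kn_jacobi\<close>).  The map \<open>V\<^sub>n \<mapsto> \<nu>\<^sup>-\<^sup>n V\<^sub>n\<close> is an isomorphism from the
  algebra with parameters \<open>(a, c)\<close> onto the one with parameters \<open>(\<nu>\<^sup>2 a, \<nu>\<^sup>4 c)\<close>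
  (\<open>kn_isomorphic_rescale\<close>); taking \<open>\<nu>\<^sup>2 = \<beta>/\<alpha>\<close> identifies the fibres over \<open>\<alpha>\<close> and \<open>\<beta>\<close>.

  The invariant that distinguishes the Witt algebra is the existence of a nonzero element whose
  adjoint action is locally finite: \<open>l\<^sub>0\<close> is one, being diagonal in the standard basis, whereas no
  such element exists when \<open>(a, c) \<noteq> (0, 0)\<close> (\<open>kn_ad_locally_finite_eq_0\<close>).  The geometric reason
  is as follows.  The algebra consists of vector fields on the curve \<open>Y\<^sup>2 = 4y(y\<^sup>2 + ay + c)\<close>, which
  are regular away from \<open>y = 0\<close> and \<open>y = \<infinity>\<close>.  In a local coordinate \<open>u\<close> at a puncture, a field
  \<open>E = \<theta> u\<^sup>e\<^sup>+\<^sup>1 d/du + \<dots>\<close> with \<open>\<theta> \<noteq> 0\<close>, said to be of weight \<open>e\<close>, cannot act locally finitely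
  if \<open>e < 0\<close>: bracketing with \<open>E\<close> repeatedly lowers the weight of a field of weight less than \<open>e\<close>
  by exactly \<open>\<bar>e\<bar>\<close> each time (\<open>not_ad_locally_finite\<close>).  So \<open>E\<close> has weight at least \<open>0\<close> at every
  puncture.  At \<open>y = \<infinity>\<close> this says that \<open>E\<close> involves only \<open>V\<^sub>n\<close> with \<open>n \<le> 0\<close>; over \<open>y = 0\<close> it says
  that \<open>E\<close> involves only \<open>V\<^sub>n\<close> with \<open>n \<ge> 3\<close> if \<open>c \<noteq> 0\<close>, where the curve has one branch, and only
  \<open>n \<ge> 1\<close> if \<open>c = 0 \<noteq> a\<close>, where it has two branches.  Hence \<open>E = 0\<close>.  The local expansions enter
  only through their leading coefficients, as a combinatorial condition on structure constants
  (\<open>leading_form\<close>).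
\<close>

section \<open>Bilinear extensions\<close>

lemma fscale_simps:
  shows "fscale c (x + y) = fscale c x + fscale c y"
    and "fscale (a + b) x = fscale a x + fscale b x"
    and "fscale a (fscale b x) = fscale (a * b) x"
    and "fscale 1 x = x" and "fscale 0 x = 0" and "fscale c 0 = 0"
    and "fscale c (- x) = - fscale c x"
    and "fscale c (x - y) = fscale c x - fscale c y"
  by (auto intro!: poly_mapping_eqI simp: lookup_add lookup_minus algebra_simps)

lemma fscale_sum: "fscale c (sum f S) = (\<Sum>i\<in>S. fscale c (f i))"
  by (induction S rule: infinite_finite_induct) (auto simp: fscale_simps)

lemma free_module_induct [case_names zero add basis]:
  assumes "P 0" and "\<And>x y. P x \<Longrightarrow> P y \<Longrightarrow> P (x + y)" and "\<And>c i. P (fscale c (V i))"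
  shows "P u"
proof -
  have "P (\<Sum>i\<in>S. fscale (Poly_Mapping.lookup u i) (V i))" for S
    by (induction S rule: infinite_finite_induct) (auto simp: assms)
  then show ?thesis
    by (metis fscale_expansion)
qed

lemma bilinear_extension_superset:
  assumes "finite S" "finite S'" "Poly_Mapping.keys x \<subseteq> S" "Poly_Mapping.keys y \<subseteq> S'"
  shows "bilinear_extension C x y =
    (\<Sum>i\<in>S. \<Sum>j\<in>S'. fscale (Poly_Mapping.lookup x i * Poly_Mapping.lookup y j) (C i j))"
proof -
  have "bilinear_extension C x y = (\<Sum>i\<in>S. \<Sum>j\<in>Poly_Mapping.keys y.
      fscale (Poly_Mapping.lookup x i * Poly_Mapping.lookup y j) (C i j))"
    unfolding bilinear_extension_def using assms
    by (intro sum.mono_neutral_left) (auto simp: in_keys_iff fscale_simps)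
  also have "\<dots> = (\<Sum>i\<in>S. \<Sum>j\<in>S'.
      fscale (Poly_Mapping.lookup x i * Poly_Mapping.lookup y j) (C i j))"
    using assms
    by (intro sum.cong sum.mono_neutral_left refl) (auto simp: in_keys_iff fscale_simps)
  finally show ?thesis .
qed

lemma bilinear_extension_add_left:
  "bilinear_extension C (x + y) z = bilinear_extension C x z + bilinear_extension C y z"
  using Poly_Mapping.keys_add[of x y]
  by (simp add: bilinear_extension_superset[of "Poly_Mapping.keys x \<union> Poly_Mapping.keys y"
        "Poly_Mapping.keys z"] lookup_add distrib_right fscale_simps sum.distrib)

lemma bilinear_extension_add_right:
  "bilinear_extension C x (y + z) = bilinear_extension C x y + bilinear_extension C x z"
  using Poly_Mapping.keys_add[of y z]
  by (simp add: bilinear_extension_superset[of "Poly_Mapping.keys x"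
        "Poly_Mapping.keys y \<union> Poly_Mapping.keys z"] lookup_add distrib_left fscale_simps sum.distrib)

lemma bilinear_extension_scale_left:
  "bilinear_extension C (fscale a x) y = fscale a (bilinear_extension C x y)"
proof -
  have "Poly_Mapping.keys (fscale a x) \<subseteq> Poly_Mapping.keys x"
    by (auto simp: in_keys_iff)
  then show ?thesis
    by (simp add: bilinear_extension_superset[of "Poly_Mapping.keys x" "Poly_Mapping.keys y"]
        fscale_sum fscale_simps mult.assoc)
qed

lemma bilinear_extension_scale_right:
  "bilinear_extension C x (fscale a y) = fscale a (bilinear_extension C x y)"
proof -
  have "Poly_Mapping.keys (fscale a y) \<subseteq> Poly_Mapping.keys y"
    by (auto simp: in_keys_iff)
  then show ?thesis
    by (simp add: bilinear_extension_superset[of "Poly_Mapping.keys x" "Poly_Mapping.keys y"]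
        fscale_sum fscale_simps mult.left_commute)
qed

lemma bilinear_extension_zero [simp]:
  "bilinear_extension C 0 y = 0" "bilinear_extension C x 0 = 0"
  by (simp_all add: bilinear_extension_def)

lemmas bilinear_extension_simps =
  bilinear_extension_add_left bilinear_extension_add_right
  bilinear_extension_scale_left bilinear_extension_scale_right bilinear_extension_V

text \<open>
  The Lie algebra axioms need only be checked on basis vectors.  The condition \<open>C i i = 0\<close> is
  separate from antisymmetry because \<open>2\<close> may fail to be cancellable in the base ring.
\<close>

lemma lie_algebra_bilinear_extension:
  assumes diag: "\<And>i. C i i = 0"
    and anti: "\<And>i j. C i j = - C j i"
    and jac: "\<And>i j k. bilinear_extension C (V i) (C j k) + bilinear_extension C (V j) (C k i)
      + bilinear_extension C (V k) (C i j) = 0"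
  shows "lie_algebra fscale (bilinear_extension C)"
proof -
  let ?B = "bilinear_extension C"
  have anti': "?B x y = - ?B y x" for x y
  proof (induction x rule: free_module_induct)
    case (basis c i)
    show ?case
      by (induction y rule: free_module_induct)
        (auto simp: bilinear_extension_simps fscale_simps anti[of i] mult.commute)
  qed (auto simp: bilinear_extension_simps)
  have self: "?B x x = 0" for x
  proof (induction x rule: free_module_induct)
    case (add x y)
    then show ?case
      using anti'[of x y] by (simp add: bilinear_extension_simps)
  qed (auto simp: bilinear_extension_simps diag fscale_simps)
  have jac': "?B x (?B y z) + ?B y (?B z x) + ?B z (?B x y) = 0" for x y z
  proof (induction x rule: free_module_induct)
    case (add x x')
    have "?B (x + x') (?B y z) + ?B y (?B z (x + x')) + ?B z (?B (x + x') y)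
        = (?B x (?B y z) + ?B y (?B z x) + ?B z (?B x y))
        + (?B x' (?B y z) + ?B y (?B z x') + ?B z (?B x' y))"
      by (simp add: bilinear_extension_simps)
    with add show ?case by simp
  next
    case (basis a i)
    show ?case
    proof (induction y rule: free_module_induct)
      case (add y y')
      let ?x = "fscale a (V i)"
      have "?B ?x (?B (y + y') z) + ?B (y + y') (?B z ?x) + ?B z (?B ?x (y + y'))
          = (?B ?x (?B y z) + ?B y (?B z ?x) + ?B z (?B ?x y))
          + (?B ?x (?B y' z) + ?B y' (?B z ?x) + ?B z (?B ?x y'))"
        by (simp add: bilinear_extension_simps fscale_simps)
      with add show ?case by simp
    next
      case (basis b j)
      show ?case
      proof (induction z rule: free_module_induct)
        case (add z z')
        let ?x = "fscale a (V i)" and ?y = "fscale b (V j)"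
        have "?B ?x (?B ?y (z + z')) + ?B ?y (?B (z + z') ?x) + ?B (z + z') (?B ?x ?y)
            = (?B ?x (?B ?y z) + ?B ?y (?B z ?x) + ?B z (?B ?x ?y))
            + (?B ?x (?B ?y z') + ?B ?y (?B z' ?x) + ?B z' (?B ?x ?y))"
          by (simp add: bilinear_extension_simps fscale_simps)
        with add show ?case by simp
      next
        case (basis c k)
        have "?B (fscale a (V i)) (?B (fscale b (V j)) (fscale c (V k)))
            + ?B (fscale b (V j)) (?B (fscale c (V k)) (fscale a (V i)))
            + ?B (fscale c (V k)) (?B (fscale a (V i)) (fscale b (V j)))
            = fscale (a * b * c) (?B (V i) (C j k) + ?B (V j) (C k i) + ?B (V k) (C i j))"
          by (simp add: bilinear_extension_simps fscale_simps mult_ac)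
        then show ?case
          by (simp add: jac fscale_simps)
      qed auto
    qed auto
  qed auto
  show ?thesis
    by (intro lie_algebra.intro module_fscale lie_algebra_axioms.intro self jac')
      (simp_all add: bilinear_extension_simps)
qed

lemma lie_algebra_hom_from_basis:
  assumes hom: "module_hom fscale fscale f"
    and f_basis: "\<And>i j. f (C i j) = bilinear_extension D (f (V i)) (f (V j))"
  shows "lie_algebra_hom fscale (bilinear_extension C) fscale (bilinear_extension D) f"
proof -
  note f_simps = module_hom.add[OF hom] module_hom.scale[OF hom] module_hom.zero[OF hom]
  have "f (bilinear_extension C x y) = bilinear_extension D (f x) (f y)" for x y
  proof (induction x rule: free_module_induct)
    case (basis c i)
    show ?case
      by (induction y rule: free_module_induct)
        (auto simp: bilinear_extension_simps f_simps f_basis)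
  qed (auto simp: bilinear_extension_simps f_simps)
  with hom show ?thesis
    by (simp add: lie_algebra_hom_def)
qed

section \<open>Change of the base ring\<close>

lemma map_coeffs_simps:
  assumes h: "unital_ring_hom h"
  shows "map_coeffs h (x + y) = map_coeffs h x + map_coeffs h y"
    and "map_coeffs h (fscale a x) = fscale (h a) (map_coeffs h x)"
    and "map_coeffs h (V i) = V i"
    and "map_coeffs h 0 = 0"
proof -
  note h0 = unital_ring_hom_0[OF h]
  have add: "h (u + v) = h u + h v" and mult: "h (u * v) = h u * h v" and one: "h 1 = 1" for u v
    using h by (auto simp: unital_ring_hom_def)
  note l = lookup_map_coeffs[of h, OF h0]
  show "map_coeffs h (x + y) = map_coeffs h x + map_coeffs h y"
    "map_coeffs h (fscale a x) = fscale (h a) (map_coeffs h x)"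
    "map_coeffs h (V i) = V i" "map_coeffs h 0 = 0"
    by (auto intro!: poly_mapping_eqI
        simp: l lookup_add add mult h0 one lookup_single when_def)
qed

lemma map_coeffs_bilinear_extension:
  assumes h: "unital_ring_hom h"
  shows "map_coeffs h (bilinear_extension C x y)
    = bilinear_extension (\<lambda>i j. map_coeffs h (C i j)) (map_coeffs h x) (map_coeffs h y)"
proof (induction x rule: free_module_induct)
  case (basis c i)
  show ?case
    by (induction y rule: free_module_induct)
      (auto simp: bilinear_extension_simps map_coeffs_simps[OF h])
qed (auto simp: bilinear_extension_simps map_coeffs_simps[OF h])

lemma unital_ring_hom_poly: "unital_ring_hom (\<lambda>p. poly p \<alpha>)"
  by (simp add: unital_ring_hom_def)

lemma unital_ring_hom_const_poly: "unital_ring_hom (\<lambda>c. [:c:])"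
  by (simp add: unital_ring_hom_def one_pCons)

section \<open>The two-parameter family of Lie algebras\<close>

text \<open>
  The coefficient of \<open>V\<^sub>n\<^sub>+\<^sub>m\<^sub>-\<^sub>2\<^sub>i\<close> in the bracket of \<open>V\<^sub>n\<close> and \<open>V\<^sub>m\<close> is \<open>kn_coeff i n m\<close> times the
  parameter \<open>a\<close> for \<open>i = 1\<close> and times the parameter \<open>c\<close> for \<open>i = 2\<close>.  The last case is the third one with the arguments exchanged and the sign reversed.
\<close>

definition kn_coeff :: "int \<Rightarrow> int \<Rightarrow> int \<Rightarrow> int" where
  "kn_coeff i n m =
    (if odd n \<and> odd m then 0
     else if even n \<and> even m then m - n
     else if odd n then m - n - i
     else m - n + i)"

text \<open>
  Structure constants of the Lie algebra of vector fields on the curve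
  \<open>Y\<^sup>2 = f(y) = 4y(y\<^sup>2 + ay + c)\<close> spanned by \<open>V\<^sub>2\<^sub>k\<^sub>+\<^sub>1 = y\<^sup>k Y d/dy\<close> and
  \<open>V\<^sub>2\<^sub>k = f y\<^sup>k\<^sup>-\<^sup>2/2 d/dy\<close>, where \<open>k\<close> runs through the integers.
\<close>

definition kn_basis :: "'a::comm_ring_1 \<Rightarrow> 'a \<Rightarrow> int \<Rightarrow> int \<Rightarrow> (int \<Rightarrow>\<^sub>0 'a)"
  where "kn_basis a c n m =
    fscale (of_int (m - n)) (V (n + m))
    + fscale (of_int (kn_coeff 1 n m) * a) (V (n + m - 2))
    + fscale (of_int (kn_coeff 2 n m) * c) (V (n + m - 4))"

text \<open>The Lie bracket with these structure constants.\<close>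

definition kn_bracket :: "'a::comm_ring_1 \<Rightarrow> 'a \<Rightarrow>
    (int \<Rightarrow>\<^sub>0 'a) \<Rightarrow> (int \<Rightarrow>\<^sub>0 'a) \<Rightarrow> (int \<Rightarrow>\<^sub>0 'a)"
  where "kn_bracket a c = bilinear_extension (kn_basis a c)"

lemma lookup_kn_basis:
  "Poly_Mapping.lookup (kn_basis a c n m) j =
     of_int (m - n) * Poly_Mapping.lookup (V (n + m)) j
     + of_int (kn_coeff 1 n m) * a * Poly_Mapping.lookup (V (n + m - 2)) j
     + of_int (kn_coeff 2 n m) * c * Poly_Mapping.lookup (V (n + m - 4)) j"
  by (simp add: kn_basis_def lookup_add)

lemma kn_basis_antisym: "kn_basis a c n m = - kn_basis a c m n"
proof -
  have "kn_coeff i n m = - kn_coeff i m n" for i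
    by (auto simp: kn_coeff_def)
  then show ?thesis
    by (intro poly_mapping_eqI)
      (simp only: lookup_kn_basis lookup_uminus, simp add: algebra_simps)
qed

lemma kn_bracket_V_basis:
  "kn_bracket a c (V p) (kn_basis a c n m) =
     fscale (of_int (m - n)) (kn_basis a c p (n + m))
     + fscale (of_int (kn_coeff 1 n m) * a) (kn_basis a c p (n + m - 2))
     + fscale (of_int (kn_coeff 2 n m) * c) (kn_basis a c p (n + m - 4))"
  unfolding kn_bracket_def kn_basis_def[of a c n m] bilinear_extension_simps ..

lemma kn_jacobi:
  fixes a c :: "'a::comm_ring_1"
  shows "kn_bracket a c (V n) (kn_basis a c m p) + kn_bracket a c (V m) (kn_basis a c p n)
    + kn_bracket a c (V p) (kn_basis a c n m) = 0"
proof (rule poly_mapping_eqI)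
  fix j :: int
  define v where "v i = (Poly_Mapping.lookup (V i) j :: 'a)" for i
  have parity: "even (x + y - 2) \<longleftrightarrow> even (x + y)" "even (x + y - 4) \<longleftrightarrow> even (x + y)" for x y :: int
    by auto
  show "Poly_Mapping.lookup
      (kn_bracket a c (V n) (kn_basis a c m p) + kn_bracket a c (V m) (kn_basis a c p n)
        + kn_bracket a c (V p) (kn_basis a c n m)) j = Poly_Mapping.lookup 0 j"
    unfolding kn_bracket_V_basis lookup_add lookup_fscale lookup_kn_basis v_def[symmetric]
      kn_coeff_def parity
    by (cases "even n"; cases "even m"; cases "even p") (simp_all add: algebra_simps)
qed

lemma lie_algebra_kn: "lie_algebra fscale (kn_bracket a c)"
  unfolding kn_bracket_def
proof (rule lie_algebra_bilinear_extension)
  show "kn_basis a c i i = 0" for i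
    by (simp add: kn_basis_def kn_coeff_def fscale_simps)
qed (use kn_basis_antisym kn_jacobi in \<open>auto simp: kn_bracket_def\<close>)

lemma unital_ring_hom_of_int:
  assumes h: "unital_ring_hom h"
  shows "h (of_int z) = of_int z"
proof -
  have add: "h (u + v) = h u + h v" and one: "h 1 = 1" for u v
    using h by (auto simp: unital_ring_hom_def)
  show ?thesis
  proof (induction z rule: int_induct[of _ 0])
    case (step2 i)
    then show ?case
      using add[of "of_int (i - 1)" 1] one by (simp add: algebra_simps)
  qed (auto simp: add one unital_ring_hom_0[OF h])
qed

lemma map_coeffs_kn_basis:
  assumes h: "unital_ring_hom h"
  shows "map_coeffs h (kn_basis a c n m) = kn_basis (h a) (h c) n m"
proof -
  have "h (u * v) = h u * h v" for u v
    using h by (auto simp: unital_ring_hom_def)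
  then show ?thesis
    by (simp only: kn_basis_def map_coeffs_simps[OF h] unital_ring_hom_of_int[OF h])
qed

lemma witt_bracket_eq_kn: "witt_bracket = kn_bracket 0 0"
proof -
  have "kn_basis 0 0 = (\<lambda>n m. fscale (of_int (m - n)) (V (n + m)) :: int \<Rightarrow>\<^sub>0 complex)"
    by (intro ext) (simp add: kn_basis_def fscale_simps)
  then show ?thesis
    by (simp add: witt_bracket_def kn_bracket_def)
qed

text \<open>The parameters \<open>a\<close> and \<open>c\<close> of the deformation family, as polynomials in \<open>t\<close>.\<close>

fun family_lin :: "ext_complex \<Rightarrow> complex poly" where
  "family_lin (Fin s) = 3 * T"
| "family_lin Infinity = 0"

fun family_quad :: "ext_complex \<Rightarrow> complex poly" where
  "family_quad (Fin s) = T\<^sup>2 * [:(1 - s) * (2 + s):]"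
| "family_quad Infinity = - (T\<^sup>2)"

lemma family_bracket_eq_kn: "family_bracket s = kn_bracket (family_lin s) (family_quad s)"
proof -
  have "family_basis_bracket s n m = kn_basis (family_lin s) (family_quad s) n m" for n m
    by (rule poly_mapping_eqI, cases s; cases "even n"; cases "even m")
      (simp_all add: family_basis_bracket_def kn_basis_def kn_coeff_def lookup_add lookup_minus
        algebra_simps del: mult_pCons_right mult_pCons_left)
  then have "family_basis_bracket s = kn_basis (family_lin s) (family_quad s)"
    by blast
  then show ?thesis
    by (simp add: family_bracket_def kn_bracket_def)
qed

lemma fibre_family_eq_kn:
  "fibre (family_bracket s) \<alpha> = kn_bracket (poly (family_lin s) \<alpha>) (poly (family_quad s) \<alpha>)"
  by (simp add: fibre_def family_bracket_eq_kn kn_bracket_def bilinear_extension_V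
      map_coeffs_kn_basis[OF unital_ring_hom_poly])

lemma affine_line_deformation_kn:
  "affine_line_deformation (kn_bracket (poly a 0) (poly c 0)) (kn_bracket a c)"
proof -
  note ev = unital_ring_hom_poly[of 0] and const = unital_ring_hom_const_poly
  have "module (\<lambda>c :: complex. fscale [:c:] :: (int \<Rightarrow>\<^sub>0 complex poly) \<Rightarrow> _)"
    by (rule module.intro) (simp_all add: fscale_simps(1,3,4) mult.commute flip: one_pCons fscale_simps(2))
  then have "module_hom (\<lambda>c :: complex. fscale [:c:]) fscale
      (map_coeffs (\<lambda>p. poly p 0) :: (int \<Rightarrow>\<^sub>0 complex poly) \<Rightarrow> _)"
    by (intro module_hom.intro module_fscale module_hom_axioms.intro)
      (simp_all add: map_coeffs_simps[OF ev])
  then have "lie_algebra_hom (\<lambda>c. fscale [:c:]) (kn_bracket a c) fscale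
      (kn_bracket (poly a 0) (poly c 0)) (map_coeffs (\<lambda>p. poly p 0))"
    by (simp add: lie_algebra_hom_def kn_bracket_def map_coeffs_bilinear_extension[OF ev]
        map_coeffs_kn_basis[OF ev])
  then show ?thesis
    by (simp add: affine_line_deformation_def global_deformation_def ev const lie_algebra_kn)
qed

section \<open>Rescaling the basis\<close>

text \<open>The linear map \<open>V\<^sub>n \<mapsto> \<nu>\<^sup>-\<^sup>n V\<^sub>n\<close>.\<close>

definition rescale :: "complex \<Rightarrow> (int \<Rightarrow>\<^sub>0 complex) \<Rightarrow> (int \<Rightarrow>\<^sub>0 complex)"
  where "rescale \<nu> = Poly_Mapping.mapp (\<lambda>n u. \<nu> powi (- n) * u)"

lemma lookup_rescale: "Poly_Mapping.lookup (rescale \<nu> x) n = \<nu> powi (- n) * Poly_Mapping.lookup x n"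
  by (simp add: rescale_def lookup_mapp when_def in_keys_iff)

lemma module_hom_rescale: "module_hom fscale fscale (rescale \<nu>)"
  by (intro module_hom.intro module_fscale module_hom_axioms.intro poly_mapping_eqI)
    (simp_all add: lookup_rescale lookup_add algebra_simps)

lemma bij_rescale:
  assumes "\<nu> \<noteq> 0"
  shows "bij (rescale \<nu>)"
proof (rule o_bij)
  show "rescale (1 / \<nu>) \<circ> rescale \<nu> = id" "rescale \<nu> \<circ> rescale (1 / \<nu>) = id"
    using assms
    by (auto intro!: ext poly_mapping_eqI simp: lookup_rescale power_int_divide_distrib
        power_int_minus field_simps)
qed

lemma rescale_V: "rescale \<nu> (V n) = fscale (\<nu> powi (- n)) (V n)"
  by (rule poly_mapping_eqI) (simp add: lookup_rescale lookup_single when_def)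

lemma kn_isomorphic_rescale:
  fixes \<nu> a c :: complex
  assumes \<nu>: "\<nu> \<noteq> 0"
  shows "lie_isomorphic fscale (kn_bracket a c) fscale (kn_bracket (\<nu>\<^sup>2 * a) (\<nu> ^ 4 * c))"
proof -
  note f = module_hom.add[OF module_hom_rescale] module_hom.scale[OF module_hom_rescale] rescale_V
  have pw: "\<nu> powi (- (n + m)) = \<nu> powi (- n) * \<nu> powi (- m)"
    "\<nu> powi (- (n + m - 2)) = \<nu> powi (- n) * \<nu> powi (- m) * \<nu>\<^sup>2"
    "\<nu> powi (- (n + m - 4)) = \<nu> powi (- n) * \<nu> powi (- m) * \<nu> ^ 4" for n m
    using \<nu> by (simp_all add: power_int_diff power_int_add power_int_minus field_simps)
  have "rescale \<nu> (kn_basis a c n m) = bilinear_extension (kn_basis (\<nu>\<^sup>2 * a) (\<nu> ^ 4 * c))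
      (rescale \<nu> (V n)) (rescale \<nu> (V m))" for n m
    by (simp only: f bilinear_extension_simps kn_basis_def pw fscale_simps mult_ac)
  then have "lie_algebra_hom fscale (kn_bracket a c) fscale (kn_bracket (\<nu>\<^sup>2 * a) (\<nu> ^ 4 * c)) (rescale \<nu>)"
    unfolding kn_bracket_def by (intro lie_algebra_hom_from_basis module_hom_rescale)
  then show ?thesis
    unfolding lie_isomorphic_def using bij_rescale[OF \<nu>] by blast
qed

lemma fibres_isomorphic:
  assumes "\<alpha> \<noteq> 0" "\<beta> \<noteq> 0"
  shows "lie_isomorphic fscale (fibre (family_bracket s) \<alpha>) fscale (fibre (family_bracket s) \<beta>)"
proof -
  define \<nu> where "\<nu> = csqrt (\<beta> / \<alpha>)"
  have \<nu>2: "\<nu>\<^sup>2 = \<beta> / \<alpha>"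
    by (simp add: \<nu>_def)
  then have \<nu>4: "\<nu> ^ 4 = \<beta>\<^sup>2 / \<alpha>\<^sup>2"
    by (metis num_double power_divide power_even_eq mult_2 numeral_Bit0 power_mult)
  have "\<nu>\<^sup>2 * poly (family_lin s) \<alpha> = poly (family_lin s) \<beta>"
    using assms by (cases s) (simp_all add: \<nu>2 T_def)
  moreover have "\<nu> ^ 4 * poly (family_quad s) \<alpha> = poly (family_quad s) \<beta>"
    using assms by (cases s) (simp_all add: \<nu>4 T_def power2_eq_square)
  moreover have "\<nu> \<noteq> 0"
    using assms by (simp add: \<nu>_def)
  ultimately show ?thesis
    by (metis kn_isomorphic_rescale fibre_family_eq_kn)
qed

section \<open>Elements with locally finite adjoint action\<close>

text \<open>
  Every element has its whole orbit under \<open>ad E\<close> in a finitely generated submodule.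
\<close>

definition ad_locally_finite ::
  "(('i \<Rightarrow>\<^sub>0 'a::comm_ring_1) \<Rightarrow> ('i \<Rightarrow>\<^sub>0 'a) \<Rightarrow> ('i \<Rightarrow>\<^sub>0 'a)) \<Rightarrow> ('i \<Rightarrow>\<^sub>0 'a) \<Rightarrow> bool"
  where "ad_locally_finite br E \<longleftrightarrow>
    (\<forall>x. \<exists>S. finite S \<and> (\<forall>k. (br E ^^ k) x \<in> module.span fscale S))"

lemma ad_locally_finite_reflect:
  assumes hom: "lie_algebra_hom fscale br1 fscale br2 f" and bij: "bij f"
    and fin: "ad_locally_finite br2 (f E)"
  shows "ad_locally_finite br1 E"
  unfolding ad_locally_finite_def
proof
  fix x
  have mh: "module_hom fscale fscale f" and br: "f (br1 u v) = br2 (f u) (f v)" for u v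
    using hom by (auto simp: lie_algebra_hom_def)
  obtain S where S: "finite S" "\<And>k. (br2 (f E) ^^ k) (f x) \<in> module.span fscale S"
    using fin unfolding ad_locally_finite_def by blast
  have iter: "f ((br1 E ^^ k) x) = (br2 (f E) ^^ k) (f x)" for k
    by (induction k) (simp_all add: br)
  have "f ` (inv f ` S) = S"
    using bij by (simp add: image_f_inv_f bij_is_surj)
  then have "module.span fscale S = f ` module.span fscale (inv f ` S)"
    using module_hom.span_image[OF mh, of "inv f ` S"] by simp
  then have "(br1 E ^^ k) x \<in> module.span fscale (inv f ` S)" for k
    using S(2)[of k] bij unfolding iter[symmetric] by (metis bij_is_inj inj_image_mem_iff)
  with S(1) show "\<exists>S. finite S \<and> (\<forall>k. (br1 E ^^ k) x \<in> module.span fscale S)"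
    by blast
qed

lemma witt_V0_ad_locally_finite: "ad_locally_finite witt_bracket (V 0)"
  unfolding ad_locally_finite_def
proof
  fix x :: "int \<Rightarrow>\<^sub>0 complex"
  let ?S = "V ` Poly_Mapping.keys x :: (int \<Rightarrow>\<^sub>0 complex) set"
  interpret module "fscale :: complex \<Rightarrow> (int \<Rightarrow>\<^sub>0 complex) \<Rightarrow> _"
    by (rule module_fscale)
  have eigen: "witt_bracket (V 0) y = (\<Sum>n\<in>Poly_Mapping.keys y.
      fscale (of_int n * Poly_Mapping.lookup y n) (V n))" for y
    by (simp add: witt_bracket_def bilinear_extension_def fscale_simps mult.commute)
  have "Poly_Mapping.keys ((witt_bracket (V 0) ^^ k) x) \<subseteq> Poly_Mapping.keys x" for k
  proof (induction k)
    case (Suc k)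
    have "Poly_Mapping.keys (witt_bracket (V 0) y) \<subseteq> Poly_Mapping.keys y" for y
    proof
      fix n assume "n \<in> Poly_Mapping.keys (witt_bracket (V 0) y)"
      then have "(\<Sum>m\<in>Poly_Mapping.keys y. of_int m * Poly_Mapping.lookup y m * (1 when m = n)) \<noteq> 0"
        unfolding in_keys_iff eigen lookup_sum by (simp add: lookup_single)
      then obtain m where "m \<in> Poly_Mapping.keys y" "m = n"
        by (metis (mono_tags, lifting) sum.neutral mult_zero_right when_def)
      then show "n \<in> Poly_Mapping.keys y" by simp
    qed
    with Suc show ?case by fastforce
  qed simp
  moreover have "y \<in> span ?S" if "Poly_Mapping.keys y \<subseteq> Poly_Mapping.keys x" for y
    using that by (subst fscale_expansion[of y]) (intro span_sum span_scale span_base, blast)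
  ultimately show "\<exists>S. finite S \<and> (\<forall>k. (witt_bracket (V 0) ^^ k) x \<in> span S)"
    by (intro exI[of _ ?S]) auto
qed

section \<open>Filtrations and leading coefficients\<close>

text \<open>
  Given weights of the basis vectors, \<open>weight_ge w d\<close> is spanned by the basis vectors of weight at
  least \<open>d\<close>.  It contains the zero element for every \<open>d\<close>.
\<close>

definition weight_ge :: "('i \<Rightarrow> int) \<Rightarrow> int \<Rightarrow> ('i \<Rightarrow>\<^sub>0 'a::comm_ring_1) set"
  where "weight_ge w d = {x. \<forall>i\<in>Poly_Mapping.keys x. d \<le> w i}"

text \<open>
  The linear functional that sends basis vectors \<open>V\<^sub>i\<close> of weight \<open>d\<close> to \<open>\<theta> i\<close> and all others to \<open>0\<close>.
  On vector fields of weight at least \<open>d\<close> at a puncture it reads off the coefficient of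
  \<open>u\<^sup>d\<^sup>+\<^sup>1 d/du\<close>, provided that \<open>V\<^sub>i = \<theta> i u\<^sup>w\<^sup>+\<^sup>1 d/du + \<dots>\<close> with \<open>w\<close> the weight of \<open>i\<close>.
\<close>

definition leading :: "('i \<Rightarrow> int) \<Rightarrow> ('i \<Rightarrow> 'a) \<Rightarrow> int \<Rightarrow> ('i \<Rightarrow>\<^sub>0 'a::comm_ring_1) \<Rightarrow> 'a"
  where "leading w \<theta> d x =
    (\<Sum>i\<in>Poly_Mapping.keys x. if w i = d then \<theta> i * Poly_Mapping.lookup x i else 0)"

lemma leading_superset:
  assumes "finite S" "Poly_Mapping.keys x \<subseteq> S"
  shows "leading w \<theta> d x = (\<Sum>i\<in>S. if w i = d then \<theta> i * Poly_Mapping.lookup x i else 0)"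
  unfolding leading_def using assms by (intro sum.mono_neutral_left) (auto simp: in_keys_iff)

lemma leading_simps:
  shows "leading w \<theta> d (x + y) = leading w \<theta> d x + leading w \<theta> d y"
    and "leading w \<theta> d (fscale a x) = a * leading w \<theta> d x"
    and "leading w \<theta> d 0 = 0"
    and "leading w \<theta> d (V i) = (if w i = d then \<theta> i else 0)"
proof -
  show "leading w \<theta> d (x + y) = leading w \<theta> d x + leading w \<theta> d y"
    using Poly_Mapping.keys_add[of x y]
    by (simp add: leading_superset[of "Poly_Mapping.keys x \<union> Poly_Mapping.keys y"] lookup_add
        distrib_left if_distrib[of "\<lambda>u. u + _"] flip: sum.distrib cong: if_cong)
  have "Poly_Mapping.keys (fscale a x) \<subseteq> Poly_Mapping.keys x"
    by (auto simp: in_keys_iff)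
  then show "leading w \<theta> d (fscale a x) = a * leading w \<theta> d x"
    by (auto simp: leading_superset[of "Poly_Mapping.keys x"] sum_distrib_left intro!: sum.cong)
qed (simp_all add: leading_def)

lemma leading_sum: "leading w \<theta> d (sum f S) = (\<Sum>i\<in>S. leading w \<theta> d (f i))"
  by (induction S rule: infinite_finite_induct) (auto simp: leading_simps)

lemma leading_eq_0: "x \<in> weight_ge w e \<Longrightarrow> d < e \<Longrightarrow> leading w \<theta> d x = 0"
  by (auto simp: leading_def weight_ge_def intro!: sum.neutral)

lemma subspace_weight_ge: "module.subspace fscale (weight_ge w d)"
proof -
  interpret module fscale by (rule module_fscale)
  show ?thesis
  proof (rule subspaceI)
    show "x + y \<in> weight_ge w d" if "x \<in> weight_ge w d" "y \<in> weight_ge w d" for x y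
      using that Poly_Mapping.keys_add[of x y] by (auto simp: weight_ge_def)
    show "fscale c x \<in> weight_ge w d" if "x \<in> weight_ge w d" for c x
    proof -
      have "Poly_Mapping.keys (fscale c x) \<subseteq> Poly_Mapping.keys x"
        by (auto simp: in_keys_iff)
      with that show ?thesis by (auto simp: weight_ge_def)
    qed
  qed (simp add: weight_ge_def)
qed

lemma V_in_weight_ge: "d \<le> w i \<Longrightarrow> V i \<in> weight_ge w d"
  by (simp add: weight_ge_def)

lemma weight_ge_antimono: "d \<le> e \<Longrightarrow> weight_ge w e \<subseteq> weight_ge w d"
  by (force simp: weight_ge_def)

text \<open>
  The bracket respects the filtration by weight, and to leading order it is the bracket
  \<open>[u\<^sup>d\<^sup>+\<^sup>1 d/du, u\<^sup>e\<^sup>+\<^sup>1 d/du] = (e - d) u\<^sup>d\<^sup>+\<^sup>e\<^sup>+\<^sup>1 d/du\<close> of vector fields on the line.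
\<close>

definition leading_form ::
  "('i \<Rightarrow> int) \<Rightarrow> ('i \<Rightarrow> 'a) \<Rightarrow> ('i \<Rightarrow> 'i \<Rightarrow> ('i \<Rightarrow>\<^sub>0 'a::comm_ring_1)) \<Rightarrow> bool"
  where "leading_form w \<theta> C \<longleftrightarrow>
    (\<forall>i j. C i j \<in> weight_ge w (w i + w j)) \<and>
    (\<forall>i j. leading w \<theta> (w i + w j) (C i j) = of_int (w j - w i) * \<theta> i * \<theta> j)"

lemma leading_form_bracket:
  fixes C :: "'i \<Rightarrow> 'i \<Rightarrow> ('i \<Rightarrow>\<^sub>0 'a::comm_ring_1)"
  assumes C: "leading_form w \<theta> C" and x: "x \<in> weight_ge w d" and y: "y \<in> weight_ge w e"
  shows "bilinear_extension C x y \<in> weight_ge w (d + e)"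
    and "leading w \<theta> (d + e) (bilinear_extension C x y)
      = of_int (e - d) * leading w \<theta> d x * leading w \<theta> e y"
proof -
  interpret module "fscale :: 'a \<Rightarrow> ('i \<Rightarrow>\<^sub>0 'a) \<Rightarrow> _"
    by (rule module_fscale)
  have Cij: "C i j \<in> weight_ge w (w i + w j)"
    "leading w \<theta> (w i + w j) (C i j) = of_int (w j - w i) * \<theta> i * \<theta> j" for i j
    using C by (auto simp: leading_form_def)
  have x': "d \<le> w i" if "i \<in> Poly_Mapping.keys x" for i
    using x that by (auto simp: weight_ge_def)
  have y': "e \<le> w j" if "j \<in> Poly_Mapping.keys y" for j
    using y that by (auto simp: weight_ge_def)
  have "C i j \<in> weight_ge w (d + e)" if "i \<in> Poly_Mapping.keys x" "j \<in> Poly_Mapping.keys y" for i j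
    using Cij(1)[of i j] weight_ge_antimono[of "d + e" "w i + w j" w] x'[OF that(1)] y'[OF that(2)]
    by auto
  then show "bilinear_extension C x y \<in> weight_ge w (d + e)"
    unfolding bilinear_extension_def
    by (intro subspace_sum subspace_scale subspace_weight_ge)
  have *: "leading w \<theta> (d + e) (C i j) =
      of_int (e - d) * (if w i = d then \<theta> i else 0) * (if w j = e then \<theta> j else 0)"
    if "i \<in> Poly_Mapping.keys x" "j \<in> Poly_Mapping.keys y" for i j
  proof (cases "w i = d \<and> w j = e")
    case False
    with x'[OF that(1)] y'[OF that(2)] have "d + e < w i + w j"
      by auto
    with False show ?thesis
      using leading_eq_0[OF Cij(1)] by auto
  qed (use Cij(2)[of i j] in auto)
  have "leading w \<theta> (d + e) (bilinear_extension C x y)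
      = (\<Sum>i\<in>Poly_Mapping.keys x. \<Sum>j\<in>Poly_Mapping.keys y.
          Poly_Mapping.lookup x i * Poly_Mapping.lookup y j * leading w \<theta> (d + e) (C i j))"
    by (simp only: bilinear_extension_def leading_sum leading_simps)
  also have "\<dots> = (\<Sum>i\<in>Poly_Mapping.keys x. \<Sum>j\<in>Poly_Mapping.keys y. of_int (e - d)
      * ((if w i = d then \<theta> i * Poly_Mapping.lookup x i else 0)
      * (if w j = e then \<theta> j * Poly_Mapping.lookup y j else 0)))"
    by (intro sum.cong refl) (simp add: *)
  also have "\<dots> = of_int (e - d) * leading w \<theta> d x * leading w \<theta> e y"
    unfolding leading_def mult.assoc unfolding sum_product unfolding sum_distrib_left ..
  finally show "leading w \<theta> (d + e) (bilinear_extension C x y)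
      = of_int (e - d) * leading w \<theta> d x * leading w \<theta> e y" .
qed

text \<open>
  If \<open>V\<^sub>i\<close> has weight below \<open>e < 0\<close>, then the \<open>k\<close>-th iterate of \<open>ad E\<close> on it has weight exactly
  \<open>w i + k e\<close>: this weight never equals \<open>e\<close>, so the factor in the leading coefficient of the next
  bracket does not vanish.  In a finitely generated submodule the weights are bounded below.
\<close>

lemma not_ad_locally_finite:
  fixes C :: "'i \<Rightarrow> 'i \<Rightarrow> ('i \<Rightarrow>\<^sub>0 'a::{idom, ring_char_0})"
  assumes C: "leading_form w \<theta> C"
    and E: "E \<in> weight_ge w e" "leading w \<theta> e E \<noteq> 0" "e < 0"
    and i: "w i < e" "\<theta> i \<noteq> 0"
  shows "\<not> ad_locally_finite (bilinear_extension C) E"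
proof
  let ?B = "bilinear_extension C"
  interpret module "fscale :: 'a \<Rightarrow> ('i \<Rightarrow>\<^sub>0 'a) \<Rightarrow> _"
    by (rule module_fscale)
  assume "ad_locally_finite ?B E"
  then obtain S where S: "finite S" "\<And>k. (?B E ^^ k) (V i) \<in> span S"
    unfolding ad_locally_finite_def by blast
  from S(1) have "\<exists>N. S \<subseteq> weight_ge w N"
  proof (induction S)
    case (insert x S)
    then obtain N where N: "S \<subseteq> weight_ge w N" by blast
    obtain M where M: "x \<in> weight_ge w M"
    proof
      show "x \<in> weight_ge w (Min (w ` Poly_Mapping.keys x))"
        by (simp add: weight_ge_def)
    qed
    have "insert x S \<subseteq> weight_ge w (min M N)"
      using N M weight_ge_antimono[of "min M N" M w] weight_ge_antimono[of "min M N" N w] by auto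
    then show ?case by blast
  qed auto
  then obtain N where "S \<subseteq> weight_ge w N" by blast
  then have span: "span S \<subseteq> weight_ge w N"
    by (intro span_minimal subspace_weight_ge)
  define d where "d k = w i + int k * e" for k
  have "(?B E ^^ k) (V i) \<in> weight_ge w (d k) \<and> leading w \<theta> (d k) ((?B E ^^ k) (V i)) \<noteq> 0" for k
  proof (induction k)
    case 0
    then show ?case
      using i by (simp add: d_def V_in_weight_ge leading_simps)
  next
    case (Suc k)
    have "int k * e \<le> 0"
      using E(3) by (simp add: mult_nonneg_nonpos)
    then have "d k \<noteq> e"
      using i(1) by (simp add: d_def)
    moreover have "d (Suc k) = e + d k"
      by (simp add: d_def algebra_simps)
    ultimately show ?case
      using leading_form_bracket[OF C E(1), of "(?B E ^^ k) (V i)" "d k"] Suc E(2) by simp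
  qed
  moreover have "\<exists>k. d k < N"
  proof -
    obtain k where k: "int k = \<bar>N - w i\<bar> + 1"
      by (metis abs_ge_zero add_nonneg_nonneg zero_le_one nonneg_int_cases)
    have "int k * e \<le> int k * (- 1)"
      using E(3) by (intro mult_left_mono) auto
    with k have "d k < N"
      unfolding d_def by linarith
    then show ?thesis ..
  qed
  then obtain k where "d k < N" ..
  ultimately show False
    using S(2)[of k] span leading_eq_0[of _ w N "d k" \<theta>] by blast
qed

text \<open>
  The lowest weight \<open>w i\<close> in \<open>E\<close> is chosen before \<open>\<theta>\<close>, so that several leading coefficients, one
  for each branch through a singular point, can be annihilated simultaneously.
\<close>

lemma ad_locally_finite_lowest_term:
  fixes C :: "'i \<Rightarrow> 'i \<Rightarrow> ('i \<Rightarrow>\<^sub>0 'a::{idom, ring_char_0})"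
  assumes fin: "ad_locally_finite (bilinear_extension C) E"
    and unbounded: "\<And>d. \<exists>i. w i < d"
    and j: "j \<in> Poly_Mapping.keys E" "w j < 0"
  obtains i where "i \<in> Poly_Mapping.keys E" "w i < 0"
    "\<And>\<theta>. leading_form w \<theta> C \<Longrightarrow> (\<And>i. \<theta> i \<noteq> 0) \<Longrightarrow> leading w \<theta> (w i) E = 0"
proof -
  define e where "e = Min (w ` Poly_Mapping.keys E)"
  have "e \<in> w ` Poly_Mapping.keys E"
    unfolding e_def using j(1) by (intro Min_in) auto
  then obtain i where i: "i \<in> Poly_Mapping.keys E" "w i = e" by auto
  have E: "E \<in> weight_ge w e"
    by (simp add: weight_ge_def e_def)
  with j have "e < 0"
    by (force simp: weight_ge_def)
  have "leading w \<theta> e E = 0" if "leading_form w \<theta> C" "\<And>i. \<theta> i \<noteq> 0" for \<theta>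
    using not_ad_locally_finite[OF that(1) E _ \<open>e < 0\<close>] unbounded[of e] fin that(2) by blast
  with i \<open>e < 0\<close> show thesis
    by (intro that[of i]) auto
qed

lemma ad_locally_finite_weight_nonneg:
  fixes C :: "'i \<Rightarrow> 'i \<Rightarrow> ('i \<Rightarrow>\<^sub>0 'a::{idom, ring_char_0})"
  assumes fin: "ad_locally_finite (bilinear_extension C) E"
    and C: "leading_form w \<theta> C" "\<And>i. \<theta> i \<noteq> 0"
    and inj: "inj w" and unbounded: "\<And>d. \<exists>i. w i < d"
    and j: "j \<in> Poly_Mapping.keys E"
  shows "0 \<le> w j"
proof (rule ccontr)
  assume "\<not> 0 \<le> w j"
  then obtain i where i: "i \<in> Poly_Mapping.keys E" "leading w \<theta> (w i) E = 0"
    using ad_locally_finite_lowest_term[OF fin unbounded j] C by (metis not_le)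
  have "leading w \<theta> (w i) E = (\<Sum>k\<in>Poly_Mapping.keys E. if k = i then \<theta> i * Poly_Mapping.lookup E i else 0)"
    unfolding leading_def using inj by (intro sum.cong) (auto dest: injD)
  also have "\<dots> = \<theta> i * Poly_Mapping.lookup E i"
    using i(1) by simp
  finally show False
    using i C(2)[of i] by (simp add: in_keys_iff)
qed

section \<open>Expansions at the punctures\<close>

lemma kn_basis_in_weight_ge:
  fixes a c :: "'a::comm_ring_1"
  assumes "d \<le> w (n + m)"
    and "kn_coeff 1 n m = 0 \<or> a = 0 \<or> d \<le> w (n + m - 2)"
    and "kn_coeff 2 n m = 0 \<or> c = 0 \<or> d \<le> w (n + m - 4)"
  shows "kn_basis a c n m \<in> weight_ge w d"
proof -
  interpret module "fscale :: 'a \<Rightarrow> (int \<Rightarrow>\<^sub>0 'a) \<Rightarrow> _"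
    by (rule module_fscale)
  have *: "fscale u (V i) \<in> weight_ge w d" if "u = 0 \<or> d \<le> w i" for u :: 'a and i
  proof (cases "u = 0")
    case True
    then show ?thesis by (simp add: subspace_0[OF subspace_weight_ge])
  next
    case False
    with that show ?thesis
      by (intro subspace_scale[OF subspace_weight_ge] V_in_weight_ge) simp
  qed
  show ?thesis
    unfolding kn_basis_def
    by (intro subspace_add[OF subspace_weight_ge] *) (use assms in auto)
qed

lemma leading_kn_basis:
  "leading w \<theta> d (kn_basis a c n m) =
     of_int (m - n) * (if w (n + m) = d then \<theta> (n + m) else 0)
     + of_int (kn_coeff 1 n m) * a * (if w (n + m - 2) = d then \<theta> (n + m - 2) else 0)
     + of_int (kn_coeff 2 n m) * c * (if w (n + m - 4) = d then \<theta> (n + m - 4) else 0)"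
  by (simp only: kn_basis_def leading_simps)

text \<open>
  At \<open>y = \<infinity>\<close> the local coordinate is \<open>u\<close> with \<open>y = u\<^sup>-\<^sup>2\<close> and \<open>Y = 2u\<^sup>-\<^sup>3 + \<dots>\<close>, so that
  \<open>V\<^sub>n = - u\<^sup>1\<^sup>-\<^sup>n d/du + \<dots>\<close>.
\<close>

lemma leading_form_infinity: "leading_form uminus (\<lambda>_. - 1) (kn_basis a c)"
  by (auto simp: leading_form_def leading_kn_basis intro!: kn_basis_in_weight_ge)

text \<open>
  At \<open>y = 0\<close>, for \<open>c = r\<^sup>2 \<noteq> 0\<close>, the local coordinate is \<open>u\<close> with \<open>y = u\<^sup>2\<close> and \<open>Y = 2ru + \<dots>\<close>, so
  that \<open>V\<^sub>n = r u\<^sup>n\<^sup>-\<^sup>1 d/du + \<dots>\<close> for odd \<open>n\<close> and \<open>V\<^sub>n = r\<^sup>2 u\<^sup>n\<^sup>-\<^sup>3 d/du + \<dots>\<close> for even \<open>n\<close>.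
\<close>

lemma leading_form_branch_point:
  fixes r :: "'a::comm_ring_1"
  shows "leading_form (\<lambda>n. if even n then n - 4 else n - 2) (\<lambda>n. if even n then r\<^sup>2 else r)
    (kn_basis a (r\<^sup>2))"
  unfolding leading_form_def
proof (intro conjI allI)
  fix n m :: int
  let ?w = "\<lambda>n :: int. if even n then n - 4 else n - 2"
  show "kn_basis a (r\<^sup>2) n m \<in> weight_ge ?w (?w n + ?w m)"
    by (rule kn_basis_in_weight_ge) (auto simp: kn_coeff_def)
  show "leading ?w (\<lambda>n. if even n then r\<^sup>2 else r) (?w n + ?w m) (kn_basis a (r\<^sup>2) n m)
      = of_int (?w m - ?w n) * (if even n then r\<^sup>2 else r) * (if even m then r\<^sup>2 else r)"
    unfolding leading_kn_basis
    by (cases "even n"; cases "even m") (simp_all add: kn_coeff_def power2_eq_square algebra_simps)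
qed

text \<open>
  If \<open>c = 0\<close> and \<open>a = r\<^sup>2 \<noteq> 0\<close>, the curve has a node at \<open>y = 0\<close>.  On the branch \<open>Y = 2ry + \<dots>\<close>, where
  \<open>y\<close> itself is a coordinate, \<open>V\<^sub>2\<^sub>k\<^sub>-\<^sub>1 = 2r y\<^sup>k d/dy + \<dots>\<close> and \<open>V\<^sub>2\<^sub>k = 2r\<^sup>2 y\<^sup>k d/dy + \<dots>\<close>.  The
  other branch belongs to \<open>-r\<close>.
\<close>

lemma leading_form_node:
  fixes r :: "'a::comm_ring_1"
  shows "leading_form (\<lambda>n. (n + 1) div 2 - 1) (\<lambda>n. if even n then 2 * r\<^sup>2 else 2 * r)
    (kn_basis (r\<^sup>2) 0)"
  unfolding leading_form_def
proof (intro conjI allI)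
  fix n m :: int
  let ?w = "\<lambda>n :: int. (n + 1) div 2 - 1"
  show "kn_basis (r\<^sup>2) 0 n m \<in> weight_ge ?w (?w n + ?w m)"
    by (rule kn_basis_in_weight_ge) (auto simp: kn_coeff_def elim!: evenE oddE)
  show "leading ?w (\<lambda>n. if even n then 2 * r\<^sup>2 else 2 * r) (?w n + ?w m) (kn_basis (r\<^sup>2) 0 n m)
      = of_int (?w m - ?w n) * (if even n then 2 * r\<^sup>2 else 2 * r) * (if even m then 2 * r\<^sup>2 else 2 * r)"
    unfolding leading_kn_basis
    by (cases "even n"; cases "even m")
      (auto simp: kn_coeff_def power2_eq_square algebra_simps elim!: evenE oddE)
qed

lemma kn_ad_locally_finite_eq_0:
  fixes a c :: complex
  assumes ac: "a \<noteq> 0 \<or> c \<noteq> 0" and fin: "ad_locally_finite (kn_bracket a c) E"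
  shows "E = 0"
proof (rule ccontr)
  assume "E \<noteq> 0"
  then obtain j where j: "j \<in> Poly_Mapping.keys E"
    by (metis all_not_in_conv keys_eq_empty)
  note fin' = fin[unfolded kn_bracket_def]
  have "0 \<le> - j"
    by (rule ad_locally_finite_weight_nonneg[OF fin' leading_form_infinity _ _ _ j])
      (auto intro: exI[of "\<lambda>i. - i < d" "1 - d" for d])
  show False
  proof (cases "c = 0")
    case False
    let ?w = "\<lambda>n :: int. if even n then n - 4 else n - 2"
    have c: "c = (csqrt c)\<^sup>2" by simp
    have "0 \<le> ?w j"
    proof (rule ad_locally_finite_weight_nonneg[OF fin' _ _ _ _ j])
      show "leading_form ?w (\<lambda>n. if even n then (csqrt c)\<^sup>2 else csqrt c) (kn_basis a c)"
        using leading_form_branch_point[of "csqrt c" a] by simp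
      show "(if even i then (csqrt c)\<^sup>2 else csqrt c) \<noteq> 0" for i :: int
        using False by simp
      show "inj ?w"
        by (auto intro!: injI split: if_splits)
      show "\<exists>i. ?w i < d" for d
        by (rule exI[of _ "2 * (d - \<bar>d\<bar>)"]) auto
    qed
    with \<open>0 \<le> - j\<close> show False
      by (auto split: if_splits)
  next
    case True
    let ?w = "\<lambda>n :: int. (n + 1) div 2 - 1"
    let ?\<theta> = "\<lambda>r :: complex. \<lambda>n :: int. if even n then 2 * r\<^sup>2 else 2 * r"
    have a: "a \<noteq> 0"
      using ac True by simp
    have unbounded: "\<exists>i. ?w i < d" for d
      by (rule exI[of _ "2 * d - 2"]) simp
    have "?w j < 0"
      using \<open>0 \<le> - j\<close> by simp
    then obtain i where i: "i \<in> Poly_Mapping.keys E"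
      "\<And>\<theta>. leading_form ?w \<theta> (kn_basis a 0) \<Longrightarrow> (\<And>i. \<theta> i \<noteq> 0) \<Longrightarrow> leading ?w \<theta> (?w i) E = 0"
      using ad_locally_finite_lowest_term[OF fin' unbounded j] True by metis
    define k where "k = (i + 1) div 2"
    let ?p = "Poly_Mapping.lookup E (2 * k)" and ?q = "Poly_Mapping.lookup E (2 * k - 1)"
    \<comment> \<open>Both branches share the lowest weight, and each of them gives one linear relation.\<close>
    have lead: "r * ?p + ?q = 0" if r: "r\<^sup>2 = a" for r
    proof -
      have "r \<noteq> 0"
        using r a by auto
      have "leading ?w (?\<theta> r) (?w i) E = 0"
        using leading_form_node[of r] r \<open>r \<noteq> 0\<close> by (intro i(2)) auto
      moreover have "leading ?w (?\<theta> r) (?w i) E = 2 * r\<^sup>2 * ?p + 2 * r * ?q"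
      proof -
        have "leading ?w (?\<theta> r) (?w i) E = (\<Sum>n\<in>Poly_Mapping.keys E \<union> {2 * k, 2 * k - 1}.
            if ?w n = ?w i then ?\<theta> r n * Poly_Mapping.lookup E n else 0)"
          by (rule leading_superset) auto
        also have "\<dots> = (\<Sum>n\<in>{2 * k, 2 * k - 1}. ?\<theta> r n * Poly_Mapping.lookup E n)"
        proof -
          have "?w n = ?w i \<longleftrightarrow> n \<in> {2 * k, 2 * k - 1}" for n
            unfolding k_def by auto
          then show ?thesis
            by (intro sum.mono_neutral_cong_right) auto
        qed
        finally show ?thesis by simp
      qed
      ultimately have "2 * r * (r * ?p + ?q) = 0"
        by (simp add: power2_eq_square algebra_simps)
      with \<open>r \<noteq> 0\<close> show ?thesis by simp
    qed
    have "csqrt a * ?p + ?q = 0" "- csqrt a * ?p + ?q = 0"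
      using lead[of "csqrt a"] lead[of "- csqrt a"] by simp_all
    then have "?q = 0" "csqrt a * ?p = 0"
      by (simp_all add: add_eq_0_iff)
    then have "?p = 0" "?q = 0"
      using a by auto
    moreover have "i = 2 * k \<or> i = 2 * k - 1"
      unfolding k_def by presburger
    ultimately show False
      using i(1) by (auto simp: in_keys_iff)
  qed
qed

lemma kn_not_isomorphic_witt:
  assumes "a \<noteq> 0 \<or> c \<noteq> 0"
  shows "\<not> lie_isomorphic fscale (kn_bracket a c) fscale witt_bracket"
proof
  assume "lie_isomorphic fscale (kn_bracket a c) fscale witt_bracket"
  then obtain f where f: "lie_algebra_hom fscale (kn_bracket a c) fscale witt_bracket f" "bij f"
    by (auto simp: lie_isomorphic_def)
  obtain E where E: "f E = V 0"
    using f(2) by (metis bij_pointE)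
  have "ad_locally_finite (kn_bracket a c) E"
    using ad_locally_finite_reflect[OF f] witt_V0_ad_locally_finite E by metis
  then have "E = 0"
    by (rule kn_ad_locally_finite_eq_0[OF assms])
  moreover have "f 0 = 0"
    using f(1) unfolding lie_algebra_hom_def by (blast intro: module_hom.zero)
  ultimately have "V 0 = (0 :: int \<Rightarrow>\<^sub>0 complex)"
    using E by simp
  then show False
    by (metis lookup_single_eq lookup_zero one_neq_zero)
qed

theorem theorem5p3:
  fixes s :: ext_complex
  shows "affine_line_deformation witt_bracket (family_bracket s)
     \<and> (\<forall>\<alpha>. lie_algebra fscale (fibre (family_bracket s) \<alpha>))
     \<and> fibre (family_bracket s) 0 = witt_bracket
     \<and> (\<forall>\<alpha> \<beta>. \<alpha> \<noteq> 0 \<longrightarrow> \<beta> \<noteq> 0 \<longrightarrow>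
           lie_isomorphic fscale (fibre (family_bracket s) \<alpha>) fscale (fibre (family_bracket s) \<beta>))
     \<and> (\<forall>\<alpha>. \<alpha> \<noteq> 0 \<longrightarrow>
           \<not> lie_isomorphic fscale (fibre (family_bracket s) \<alpha>) fscale witt_bracket)"
proof (intro conjI allI impI)
  have zero: "poly (family_lin s) 0 = 0" "poly (family_quad s) 0 = 0"
    by (cases s; simp add: T_def power2_eq_square)+
  show "affine_line_deformation witt_bracket (family_bracket s)"
    using affine_line_deformation_kn[of "family_lin s" "family_quad s"]
    by (simp add: zero witt_bracket_eq_kn family_bracket_eq_kn)
  show "fibre (family_bracket s) 0 = witt_bracket"
    by (simp add: fibre_family_eq_kn zero witt_bracket_eq_kn)
  show "lie_algebra fscale (fibre (family_bracket s) \<alpha>)" for \<alpha>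
    by (simp add: fibre_family_eq_kn lie_algebra_kn)
  show "lie_isomorphic fscale (fibre (family_bracket s) \<alpha>) fscale (fibre (family_bracket s) \<beta>)"
    if "\<alpha> \<noteq> 0" "\<beta> \<noteq> 0" for \<alpha> \<beta>
    using that by (rule fibres_isomorphic)
  show "\<not> lie_isomorphic fscale (fibre (family_bracket s) \<alpha>) fscale witt_bracket"
    if "\<alpha> \<noteq> 0" for \<alpha>
    unfolding fibre_family_eq_kn
    by (rule kn_not_isomorphic_witt) (use that in \<open>cases s; simp add: T_def\<close>)
qed

end
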